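(* Let $\Psi\in\mathbb{R}^{n\times n}$ satisfy $\Psi=\Psi^\top\succeq 0$, let $\Phi\in\mathbb{R}^{n\times n}$ be Hurwitz, let $\Theta=\int_0^\infty e^{\Phi^\top t}\Psi e^{\Phi t}\,dt$, and let $c(\Phi)=\log(5/4)\,\|\Phi\|^{-1}$. Then $\|\Theta\|\ge \tfrac12 c(\Phi)\|\Psi\|$.
   Context: $\|\cdot\|$ denotes the spectral norm of a matrix. A matrix is Hurwitz if all its eigenvalues have negative real part. *)

theory Defs
  imports "HOL-Analysis.Analysis"
begin

fun matpow :: "real^'n^'n \<Rightarrow> nat \<Rightarrow> real^'n^'n" where
  "matpow A 0 = mat 1"
| "matpow A (Suc k) = A ** matpow A k"

definition mat_exp :: "real^'n^'n \<Rightarrow> real^'n^'n" where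
  "mat_exp A = (\<Sum>k. (1 / fact k) *\<^sub>R matpow A k)"

definition spectral_norm :: "real^'n^'n \<Rightarrow> real" where
  "spectral_norm A = onorm (\<lambda>x. A *v x)"

definition eigenvalue :: "real^'n^'n \<Rightarrow> complex \<Rightarrow> bool" where
  "eigenvalue A z \<longleftrightarrow>
     det ((\<chi> i j. (if i = j then z else 0) - complex_of_real (A $ i $ j)) :: complex^'n^'n) = 0"

definition hurwitz :: "real^'n^'n \<Rightarrow> bool" where
  "hurwitz A \<longleftrightarrow> (\<forall>z. eigenvalue A z \<longrightarrow> Re z < 0)"

end

(*
  Pick a unit vector v with v^T \<Psi> v = \<parallel>\<Psi>\<parallel>, which exists because \<Psi> is positive
  semidefinite. Then v^T \<Theta> v is the integral over [0, \<infinity>) of the nonnegative function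
  q(t) = (e^(\<Phi> t) v)^T \<Psi> (e^(\<Phi> t) v). As long as t \<parallel>\<Phi>\<parallel> \<le> log (5/4) we have
  \<parallel>e^(\<Phi> t) v - v\<parallel> \<le> e^(t \<parallel>\<Phi>\<parallel>) - 1 \<le> 1/4, which keeps q(t) \<ge> \<parallel>\<Psi>\<parallel> / 2, and
  integrating over [0, c(\<Phi>)] gives \<parallel>\<Theta>\<parallel> \<ge> v^T \<Theta> v \<ge> c(\<Phi>) \<parallel>\<Psi>\<parallel> / 2.

  The Hurwitz hypothesis is needed only for the integral to exist. If the spectrum of \<Phi>
  lies in the open left half-plane, then for small h > 0 the spectrum of B = I + h \<Phi> lies
  in the open unit disc, so by the Jordan normal form some power B^N halves every vector.
  Then V(y) = \<Sum>k<N. \<parallel>B^k y\<parallel>^2 is a quadratic Lyapunov function for the flow of \<Phi>,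
  so e^(\<Phi> t) decays exponentially.
*)

theory Submission
  imports Defs "Jordan_Normal_Form.Spectral_Radius"
begin

no_notation Matrix.vec_index (infixl \<open>$\<close> 100)
no_notation Matrix.scalar_prod (infix \<open>\<bullet>\<close> 70)
hide_const (open) Matrix.mat Determinant.det Char_Poly.eigenvalue

section \<open>Bounded operators as a Banach algebra\<close>

(* Wrapping the bounded linear endomorphisms in a type of their own, with composition as
   product, makes the library's exponential on Banach algebras available for matrices. *)
typedef (overloaded) 'a blinop = "UNIV :: ('a::real_normed_vector \<Rightarrow>\<^sub>L 'a) set"
  by simp

setup_lifting type_definition_blinop

lift_definition blinop_apply :: "'a::real_normed_vector blinop \<Rightarrow> 'a \<Rightarrow> 'a" is blinfun_apply .

instantiation blinop :: (real_normed_vector) real_normed_vector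
begin
lift_definition norm_blinop :: "'a blinop \<Rightarrow> real" is norm .
lift_definition minus_blinop :: "'a blinop \<Rightarrow> 'a blinop \<Rightarrow> 'a blinop" is minus .
lift_definition dist_blinop :: "'a blinop \<Rightarrow> 'a blinop \<Rightarrow> real" is dist .
definition uniformity_blinop :: "('a blinop \<times> 'a blinop) filter" where
  "uniformity_blinop = (INF e\<in>{0 <..}. principal {(x, y). dist x y < e})"
definition open_blinop :: "'a blinop set \<Rightarrow> bool" where
  "open_blinop U = (\<forall>x\<in>U. eventually (\<lambda>(x', y). x' = x \<longrightarrow> y \<in> U) uniformity)"
lift_definition uminus_blinop :: "'a blinop \<Rightarrow> 'a blinop" is uminus .
lift_definition zero_blinop :: "'a blinop" is 0 .
lift_definition plus_blinop :: "'a blinop \<Rightarrow> 'a blinop \<Rightarrow> 'a blinop" is plus .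
lift_definition scaleR_blinop :: "real \<Rightarrow> 'a blinop \<Rightarrow> 'a blinop" is scaleR .
lift_definition sgn_blinop :: "'a blinop \<Rightarrow> 'a blinop" is sgn .
instance
  apply standard
  unfolding open_blinop_def uniformity_blinop_def
  by (transfer, simp add: algebra_simps scaleR_add_left norm_triangle_ineq sgn_div_norm dist_norm)+
end

instance blinop :: (banach) banach
proof
  fix X :: "nat \<Rightarrow> 'a blinop"
  have dist_Rep: "dist x y = dist (Rep_blinop x) (Rep_blinop y)" for x y :: "'a blinop"
    by transfer simp
  assume "Cauchy X"
  then have "Cauchy (\<lambda>n. Rep_blinop (X n))"
    unfolding Cauchy_def dist_Rep .
  then obtain L where "(\<lambda>n. Rep_blinop (X n)) \<longlonglongrightarrow> L"
    using Cauchy_convergent_iff convergent_def by blast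
  then have "X \<longlonglongrightarrow> Abs_blinop L"
    unfolding tendsto_iff dist_Rep by (simp add: Abs_blinop_inverse)
  then show "convergent X"
    unfolding convergent_def by blast
qed

instantiation blinop :: (euclidean_space) real_normed_algebra_1
begin
lift_definition one_blinop :: "'a blinop" is id_blinfun .
lift_definition times_blinop :: "'a blinop \<Rightarrow> 'a blinop \<Rightarrow> 'a blinop" is blinfun_compose .
instance
proof
  fix a b c :: "'a blinop" and r :: real
  show "a * b * c = a * (b * c)"
    by transfer (auto intro: blinfun_eqI)
  show "(a + b) * c = a * c + b * c" "a * (b + c) = a * b + a * c"
    by (transfer, auto intro!: blinfun_eqI simp: blinfun.bilinear_simps)+
  show "1 * a = a" "a * 1 = a"
    by (transfer, auto intro: blinfun_eqI)+
  show "r *\<^sub>R a * b = r *\<^sub>R (a * b)" "a * r *\<^sub>R b = r *\<^sub>R (a * b)"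
    by (transfer, auto intro!: blinfun_eqI simp: blinfun.bilinear_simps)+
  show "norm (a * b) \<le> norm a * norm b"
    by transfer (rule norm_blinfun_compose)
  show norm_one: "norm (1::'a blinop) = 1"
    by transfer simp
  show "(0::'a blinop) \<noteq> 1"
    using norm_one by (metis norm_zero zero_neq_one)
qed
end

lemma blinop_apply_times [simp]: "blinop_apply (X * Y) x = blinop_apply X (blinop_apply Y x)"
  by transfer simp

lemma blinop_apply_one [simp]: "blinop_apply 1 x = x"
  by transfer simp

lemma blinop_apply_diff [simp]: "blinop_apply (X - Y) x = blinop_apply X x - blinop_apply Y x"
  by transfer (simp add: blinfun.bilinear_simps)

lemma norm_blinop_apply_le: "norm (blinop_apply X x) \<le> norm X * norm x"
  by transfer (rule norm_blinfun)

lemma bounded_linear_blinop_apply_left: "bounded_linear (\<lambda>X. blinop_apply X x)"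
proof -
  have "bounded_linear (\<lambda>X. blinfun_apply X x)"
    by (rule blinfun.bounded_linear_left)
  moreover have "bounded_linear Rep_blinop"
    by (rule bounded_linear_intro[where K=1]) (transfer, simp)+
  ultimately show ?thesis
    unfolding blinop_apply.rep_eq by (rule bounded_linear_compose)
qed

lemma blinop_eqI: "(\<And>x. blinop_apply X x = blinop_apply Y x) \<Longrightarrow> X = Y"
  by transfer (rule blinfun_eqI)

section \<open>Matrix powers, spectral norm and matrix exponential\<close>

lemma matpow_Suc_right: "matpow A (Suc k) = matpow A k ** A"
  by (induction k) (simp_all add: matrix_mul_assoc)

lemma matpow_scaleR: "matpow (c *\<^sub>R A) k = c ^ k *\<^sub>R matpow A k"
proof (induction k)
  case (Suc k)
  have "(c *\<^sub>R A) ** (c ^ k *\<^sub>R matpow A k) = (c * c ^ k) *\<^sub>R (A ** matpow A k)"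
    by (simp add: matrix_matrix_mult_def Finite_Cartesian_Product.vec_eq_iff sum_distrib_left
        algebra_simps)
  with Suc show ?case
    by simp
qed simp

lemma bounded_linear_matrix_vector_mul_left: "bounded_linear (\<lambda>A::real^'n^'m. A *v x)"
  unfolding linear_conv_bounded_linear[symmetric]
  by (rule linearI) (simp_all add: matrix_vector_mult_add_rdistrib scaleR_matrix_vector_assoc)

lemma spectral_norm_nonneg: "0 \<le> spectral_norm A"
  unfolding spectral_norm_def by (rule onorm_pos_le) simp

lemma norm_matrix_vector_le: "norm (A *v x) \<le> spectral_norm A * norm x"
  unfolding spectral_norm_def by (rule onorm) simp

lemma norm_matrix_le_entries:
  fixes A :: "real^'n^'m"
  assumes "\<And>i j. \<bar>A $ i $ j\<bar> \<le> d"
  shows "norm A \<le> real CARD('m) * real CARD('n) * d"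
proof -
  have "norm A \<le> (\<Sum>i\<in>UNIV. norm (A $ i))"
    unfolding norm_vec_def by (rule L2_set_le_sum) simp
  also have "\<dots> \<le> (\<Sum>i\<in>(UNIV::'m set). real CARD('n) * d)"
    by (intro sum_mono order_trans[OF norm_le_l1_cart] sum_bounded_above assms)
  finally show ?thesis
    by simp
qed

lemma abs_entry_le_spectral_norm: "\<bar>A $ i $ j\<bar> \<le> spectral_norm A"
  using component_le_onorm[of "(*v) A" i j]
  by (simp add: spectral_norm_def matrix_of_matrix_vector_mul)

lift_definition blinop_of_matrix :: "real^'n^'n \<Rightarrow> (real^'n) blinop"
  is "\<lambda>A. Blinfun ((*v) A)" .

lemma blinop_apply_blinop_of_matrix [simp]: "blinop_apply (blinop_of_matrix A) x = A *v x"
  by transfer (simp add: bounded_linear_Blinfun_apply)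

lemma blinop_of_matrix_scaleR: "blinop_of_matrix (t *\<^sub>R A) = t *\<^sub>R blinop_of_matrix A"
  by transfer
    (auto intro!: blinfun_eqI
      simp: bounded_linear_Blinfun_apply scaleR_blinfun.rep_eq scaleR_matrix_vector_assoc)

lemma norm_blinop_of_matrix: "norm (blinop_of_matrix A) = spectral_norm A"
  unfolding spectral_norm_def
  by transfer (simp add: norm_blinfun.rep_eq bounded_linear_Blinfun_apply)

lemma blinop_of_matrix_matpow: "blinop_of_matrix (matpow A k) = blinop_of_matrix A ^ k"
proof (induction k)
  case (Suc k)
  then show ?case
    by (intro blinop_eqI) (simp add: matrix_vector_mul_assoc[symmetric] flip: Suc)
qed (simp add: blinop_eqI)

lemma spectral_norm_matpow_le: "spectral_norm (matpow A k) \<le> spectral_norm A ^ k"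
  using norm_power_ineq[of "blinop_of_matrix A" k]
  by (simp add: norm_blinop_of_matrix blinop_of_matrix_matpow[symmetric])

lemma summable_mat_exp:
  fixes A :: "real^'n^'n"
  shows "summable (\<lambda>k. (1 / fact k) *\<^sub>R matpow A k)"
proof (rule summable_comparison_test)
  let ?c = "real CARD('n) * real CARD('n)"
  show "summable (\<lambda>k. ?c * (inverse (fact k) * spectral_norm A ^ k))"
    by (intro summable_mult summable_exp)
  have "norm (matpow A k) \<le> ?c * spectral_norm A ^ k" for k
    by (rule norm_matrix_le_entries)
      (rule order_trans[OF abs_entry_le_spectral_norm spectral_norm_matpow_le])
  then show "\<exists>N. \<forall>k\<ge>N. norm ((1 / fact k) *\<^sub>R matpow A k)
      \<le> ?c * (inverse (fact k) * spectral_norm A ^ k)"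
    by (auto simp: divide_simps mult_left_mono)
qed

lemma mat_exp_apply: "mat_exp (t *\<^sub>R A) *v x = blinop_apply (exp (t *\<^sub>R blinop_of_matrix A)) x"
proof -
  let ?term = "\<lambda>k. ((1 / fact k) *\<^sub>R matpow (t *\<^sub>R A) k) *v x"
  have "?term sums (mat_exp (t *\<^sub>R A) *v x)"
    unfolding mat_exp_def
    by (intro bounded_linear.sums[OF bounded_linear_matrix_vector_mul_left]
        summable_sums summable_mat_exp)
  moreover have "?term sums blinop_apply (exp (blinop_of_matrix (t *\<^sub>R A))) x"
  proof -
    let ?X = "blinop_of_matrix (t *\<^sub>R A)"
    have term_eq: "?X ^ k /\<^sub>R fact k = blinop_of_matrix ((1 / fact k) *\<^sub>R matpow (t *\<^sub>R A) k)" for k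
      by (simp add: blinop_of_matrix_scaleR blinop_of_matrix_matpow divide_inverse_commute)
    have "(\<lambda>k. blinop_apply (?X ^ k /\<^sub>R fact k) x) sums blinop_apply (exp ?X) x"
      by (rule bounded_linear.sums[OF bounded_linear_blinop_apply_left exp_converges])
    then show ?thesis
      unfolding term_eq by simp
  qed
  ultimately show ?thesis
    by (simp add: sums_unique2 blinop_of_matrix_scaleR)
qed

lemma mat_exp_zero_apply [simp]: "mat_exp 0 *v v = v"
  using mat_exp_apply[of 0 _ v] by simp

lemma mat_exp_has_vector_derivative:
  "((\<lambda>t. mat_exp (t *\<^sub>R A) *v x) has_vector_derivative A *v (mat_exp (t *\<^sub>R A) *v x))
     (at t within T)"
proof -
  let ?X = "blinop_of_matrix A"
  have "((\<lambda>t. exp (t *\<^sub>R ?X)) has_vector_derivative ?X * exp (t *\<^sub>R ?X)) (at t within T)"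
    using exp_scaleR_has_vector_derivative_right exp_times_scaleR_commute by metis
  from bounded_linear.has_vector_derivative[OF bounded_linear_blinop_apply_left this, of x]
  show ?thesis
    by (simp add: mat_exp_apply)
qed

lemma continuous_on_mat_exp_apply: "continuous_on S (\<lambda>t. mat_exp (t *\<^sub>R A) *v x)"
  by (rule continuous_at_imp_continuous_on)
    (auto intro: has_vector_derivative_continuous[OF mat_exp_has_vector_derivative])

lemma norm_exp_minus_one_le:
  fixes X :: "'a::{real_normed_algebra_1,banach}"
  shows "norm (exp X - 1) \<le> exp (norm X) - 1"
proof -
  have series: "(\<lambda>n. X ^ Suc n /\<^sub>R fact (Suc n)) sums (exp X - 1)"
    using sums_Suc_iff[of "\<lambda>n. X ^ n /\<^sub>R fact n"] exp_converges[of X] by simp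
  have majorant: "(\<lambda>n. norm X ^ Suc n /\<^sub>R fact (Suc n)) sums (exp (norm X) - 1)"
    using sums_Suc_iff[of "\<lambda>n. norm X ^ n /\<^sub>R fact n"] exp_converges[of "norm X"] by simp
  have "norm (X ^ Suc n /\<^sub>R fact (Suc n)) \<le> norm X ^ Suc n /\<^sub>R fact (Suc n)" for n
    using norm_power_ineq[of X "Suc n"] by (simp add: divide_right_mono del: power_Suc)
  from norm_suminf_le[OF this sums_summable[OF majorant]] series majorant show ?thesis
    by (simp add: sums_unique[symmetric])
qed

lemma norm_mat_exp_apply_diff_le:
  "norm (mat_exp (t *\<^sub>R A) *v v - v) \<le> (exp (\<bar>t\<bar> * spectral_norm A) - 1) * norm v"
proof -
  let ?X = "t *\<^sub>R blinop_of_matrix A"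
  have "norm (mat_exp (t *\<^sub>R A) *v v - v) = norm (blinop_apply (exp ?X - 1) v)"
    by (simp add: mat_exp_apply)
  also have "\<dots> \<le> norm (exp ?X - 1) * norm v"
    by (rule norm_blinop_apply_le)
  also have "\<dots> \<le> (exp (norm ?X) - 1) * norm v"
    by (intro mult_right_mono norm_exp_minus_one_le) simp
  finally show ?thesis
    by (simp add: norm_blinop_of_matrix)
qed

lemma norm_mat_exp_apply_diff_le_quarter:
  assumes "0 \<le> t" "t * spectral_norm A \<le> ln (5/4)"
  shows "norm (mat_exp (t *\<^sub>R A) *v v - v) \<le> 1/4 * norm v"
proof -
  have "exp (\<bar>t\<bar> * spectral_norm A) \<le> 5/4"
    using assms exp_le_cancel_iff[of "t * spectral_norm A" "ln (5/4)"] by simp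
  then have "(exp (\<bar>t\<bar> * spectral_norm A) - 1) * norm v \<le> 1/4 * norm v"
    by (intro mult_right_mono) auto
  with norm_mat_exp_apply_diff_le[of t A v] show ?thesis
    by linarith
qed

section \<open>Eigenvalues via the Jordan normal form library\<close>

(* The Jordan normal form library works with complex matrices indexed by natural numbers;
   enum_index identifies the finite index type with {0..<CARD('n)}. *)
definition enum_index :: "nat \<Rightarrow> 'n::finite" where
  "enum_index = (SOME e. bij_betw e {0..<CARD('n)} UNIV)"

lemma bij_betw_enum_index: "bij_betw (enum_index :: nat \<Rightarrow> 'n::finite) {0..<CARD('n)} UNIV"
  using someI_ex[OF ex_bij_betw_nat_finite[of "UNIV :: 'n set"]]
  by (simp add: enum_index_def)

lemma enum_index_inj_iff:
  "i < CARD('n) \<Longrightarrow> j < CARD('n) \<Longrightarrow> (enum_index i :: 'n::finite) = enum_index j \<longleftrightarrow> i = j"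
  using bij_betw_imp_inj_on[OF bij_betw_enum_index[where 'n='n]] by (auto simp: inj_on_def)

lemma enum_index_surj:
  fixes a :: "'n::finite"
  obtains i where "i < CARD('n)" "enum_index i = a"
  using bij_betw_enum_index[where 'n='n] by (metis UNIV_I atLeastLessThan_iff bij_betw_def imageE)

lemma sum_enum_index:
  "(\<Sum>k<CARD('n). f (enum_index k :: 'n::finite)) = (\<Sum>a\<in>UNIV. f a)"
  using sum.reindex_bij_betw[OF bij_betw_enum_index, of f] by (simp add: atLeast0LessThan)

definition from_hma_cmat :: "real^'n^'n \<Rightarrow> complex mat" where
  "from_hma_cmat A =
     Matrix.mat CARD('n) CARD('n) (\<lambda>(i, j). complex_of_real (A $ enum_index i $ enum_index j))"

definition from_hma_vec :: "'a^'n \<Rightarrow> 'a vec" where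
  "from_hma_vec w = vec CARD('n) (\<lambda>i. w $ enum_index i)"

definition of_real_matrix :: "real^'n^'m \<Rightarrow> complex^'n^'m" where
  "of_real_matrix A = (\<chi> i j. complex_of_real (A $ i $ j))"

lemma from_hma_cmat_carrier: "from_hma_cmat (A :: real^'n^'n) \<in> carrier_mat CARD('n) CARD('n)"
  by (simp add: from_hma_cmat_def)

lemma dim_from_hma_cmat [simp]:
  "dim_row (from_hma_cmat (A :: real^'n^'n)) = CARD('n)" "dim_col (from_hma_cmat A) = CARD('n)"
  by (simp_all add: from_hma_cmat_def)

lemma index_from_hma_cmat [simp]:
  "i < CARD('n) \<Longrightarrow> j < CARD('n) \<Longrightarrow>
    from_hma_cmat (A :: real^'n^'n) $$ (i, j) = complex_of_real (A $ enum_index i $ enum_index j)"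
  by (simp add: from_hma_cmat_def)

lemma from_hma_cmat_mult:
  "from_hma_cmat (A ** B) = from_hma_cmat A * from_hma_cmat (B :: real^'n^'n)"
proof (rule eq_matI)
  fix i j
  assume "i < dim_row (from_hma_cmat A * from_hma_cmat B)"
    and "j < dim_col (from_hma_cmat A * from_hma_cmat B)"
  then show "from_hma_cmat (A ** B) $$ (i, j) = (from_hma_cmat A * from_hma_cmat B) $$ (i, j)"
    using sum_enum_index[of "\<lambda>a. complex_of_real (A $ enum_index i $ a * B $ a $ enum_index j)"]
    by (simp add: scalar_prod_def matrix_matrix_mult_def atLeast0LessThan)
qed simp_all

lemma from_hma_cmat_one: "from_hma_cmat (mat 1 :: real^'n^'n) = 1\<^sub>m CARD('n)"
  by (rule eq_matI) (auto simp: Finite_Cartesian_Product.mat_def enum_index_inj_iff)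

lemma from_hma_cmat_matpow: "from_hma_cmat (matpow A k) = from_hma_cmat A ^\<^sub>m k"
  by (induction k)
    (simp_all only: matpow_Suc_right from_hma_cmat_mult from_hma_cmat_one matpow.simps(1)
      pow_mat.simps dim_from_hma_cmat)

lemma from_hma_vec_carrier: "from_hma_vec (w :: 'a^'n) \<in> carrier_vec CARD('n)"
  by (simp add: from_hma_vec_def)

lemma from_hma_vec_eq_iff: "from_hma_vec w = from_hma_vec w' \<longleftrightarrow> w = (w' :: 'a^'n)"
proof
  assume eq: "from_hma_vec w = from_hma_vec w'"
  show "w = w'"
  proof (rule iffD2[OF Finite_Cartesian_Product.vec_eq_iff], rule allI)
    fix a :: 'n
    obtain i where "i < CARD('n)" "enum_index i = a"
      by (rule enum_index_surj[of a])
    with arg_cong[OF eq, of "\<lambda>v. Matrix.vec_index v i"] show "w $ a = w' $ a"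
      by (simp add: from_hma_vec_def)
  qed
qed simp

lemma from_hma_vec_zero: "from_hma_vec (0 :: 'a::zero^'n) = 0\<^sub>v CARD('n)"
  by (simp add: from_hma_vec_def zero_vec_def)

lemma from_hma_vec_scale: "from_hma_vec (z *s w) = z \<cdot>\<^sub>v from_hma_vec w"
  by (rule eq_vecI) (simp_all add: from_hma_vec_def)

lemma from_hma_vec_surj:
  assumes "v \<in> carrier_vec CARD('n)"
  shows "\<exists>w :: 'a^'n. v = from_hma_vec w"
proof
  let ?w = "(\<chi> a. Matrix.vec_index v (inv_into {0..<CARD('n)} enum_index a)) :: 'a^'n"
  show "v = from_hma_vec ?w"
    using assms bij_betw_inv_into_left[OF bij_betw_enum_index[where 'n='n]]
    by (intro eq_vecI) (auto simp: from_hma_vec_def)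
qed

lemma from_hma_cmat_mult_vec:
  "from_hma_cmat A *\<^sub>v from_hma_vec w = from_hma_vec (of_real_matrix A *v w)"
proof (rule eq_vecI)
  fix i
  assume "i < dim_vec (from_hma_vec (of_real_matrix A *v w))"
  then show "Matrix.vec_index (from_hma_cmat A *\<^sub>v from_hma_vec w) i
      = Matrix.vec_index (from_hma_vec (of_real_matrix A *v w)) i"
    using sum_enum_index[of "\<lambda>a. complex_of_real (A $ enum_index i $ a) * w $ a"]
    by (simp add: from_hma_vec_def mult_mat_vec_def scalar_prod_def matrix_vector_mult_def
        of_real_matrix_def atLeast0LessThan row_def)
qed (simp add: from_hma_vec_def)

lemma det_eq_0_iff_kernel:
  fixes D :: "'a::field^'n^'n"
  shows "det D = 0 \<longleftrightarrow> (\<exists>w. w \<noteq> 0 \<and> D *v w = 0)"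
  using det_nz_iff_inj_gen[OF matrix_vector_mul_linear_gen, of D]
  by (auto simp: vec.inj_iff_eq_0 matrix_of_matrix_vector_mul)

lemma eigenvalue_iff_eigenvector:
  "eigenvalue A z \<longleftrightarrow> (\<exists>w. w \<noteq> 0 \<and> of_real_matrix A *v w = z *s w)"
proof -
  have "(\<chi> i j. (if i = j then z else 0) - complex_of_real (A $ i $ j)) *v w
      = z *s w - of_real_matrix A *v w" for w
    by (simp add: Finite_Cartesian_Product.vec_eq_iff matrix_vector_mult_def of_real_matrix_def
        left_diff_distrib sum_subtractf if_distrib[of "\<lambda>x. x * _"] cong: if_cong)
  then show ?thesis
    unfolding Defs.eigenvalue_def det_eq_0_iff_kernel by (simp add: eq_commute[of "z *s _"])
qed

lemma eigenvalue_from_hma_cmat_iff: "Char_Poly.eigenvalue (from_hma_cmat A) z \<longleftrightarrow> eigenvalue A z"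
proof -
  have "eigenvector (from_hma_cmat A) (from_hma_vec w) z
      \<longleftrightarrow> w \<noteq> 0 \<and> of_real_matrix A *v w = z *s w" for w
    unfolding eigenvector_def
    by (simp add: from_hma_vec_carrier from_hma_cmat_mult_vec
        flip: from_hma_vec_zero from_hma_vec_scale)
      (simp add: from_hma_vec_eq_iff)
  then show ?thesis
    unfolding Char_Poly.eigenvalue_def eigenvalue_iff_eigenvector
    by (metis eigenvector_def dim_from_hma_cmat(1) from_hma_vec_surj)
qed

lemma spectrum_from_hma_cmat: "spectrum (from_hma_cmat A) = {z. eigenvalue A z}"
  by (simp add: spectrum_def eigenvalue_from_hma_cmat_iff[abs_def])

lemma finite_eigenvalues: "finite {z. eigenvalue (A :: real^'n^'n) z}"
  using card_finite_spectrum(1)[OF from_hma_cmat_carrier] by (simp add: spectrum_from_hma_cmat)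

lemma of_real_matrix_affine_mult:
  "of_real_matrix (c *\<^sub>R (mat 1 + h *\<^sub>R A)) *v w
     = complex_of_real c *s (w + complex_of_real h *s (of_real_matrix A *v w))"
  by (simp add: Finite_Cartesian_Product.vec_eq_iff matrix_vector_mult_def of_real_matrix_def
      Finite_Cartesian_Product.mat_def distrib_left distrib_right sum.distrib sum_distrib_left
      if_distrib[of "\<lambda>x. x * _"] if_distrib[of complex_of_real] if_distrib[of "\<lambda>x. _ * x"]
      mult_ac cong: if_cong)

lemma eigenvalue_affine_iff:
  assumes "c \<noteq> 0" "h \<noteq> 0"
  shows "eigenvalue (c *\<^sub>R (mat 1 + h *\<^sub>R A)) \<mu> \<longleftrightarrow> eigenvalue A ((\<mu> / c - 1) / h)"
proof -
  have solve: "complex_of_real c *s (w + complex_of_real h *s v) = \<mu> *s w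
      \<longleftrightarrow> v = ((\<mu> / c - 1) / h) *s w" for v w :: "complex^'n"
    using assms by (auto simp: Finite_Cartesian_Product.vec_eq_iff field_simps)
  show ?thesis
    unfolding eigenvalue_iff_eigenvector of_real_matrix_affine_mult solve ..
qed

lemma matpow_entries_bounded:
  fixes A :: "real^'n^'n"
  assumes "\<And>z. eigenvalue A z \<Longrightarrow> cmod z < 1"
  shows "\<exists>c. \<forall>k a b. \<bar>matpow A k $ a $ b\<bar> \<le> c"
proof -
  have "spectral_radius (from_hma_cmat A) \<in> norm ` {z. eigenvalue A z}"
    using spectral_radius_mem_max(1)[OF from_hma_cmat_carrier] by (simp add: spectrum_from_hma_cmat)
  then have "spectral_radius (from_hma_cmat A) < 1"
    using assms by auto
  then obtain c where c: "norm_bound (from_hma_cmat A ^\<^sub>m k) c" for k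
    using spectral_radius_jnf_norm_bound_less_1_upper_triangular[OF from_hma_cmat_carrier] by blast
  have "\<bar>matpow A k $ a $ b\<bar> \<le> c" for k a b
  proof -
    obtain i j where "i < CARD('n)" "enum_index i = a" "j < CARD('n)" "enum_index j = b"
      by (metis enum_index_surj)
    with c[of k] show ?thesis
      by (auto simp: norm_bound_def simp flip: from_hma_cmat_matpow)
  qed
  then show ?thesis
    by blast
qed

section \<open>Exponential decay for Hurwitz matrices\<close>

lemma euler_step_contraction:
  assumes "finite S" "\<And>z. z \<in> S \<Longrightarrow> Re z < 0"
  obtains h r where "h > 0" "0 < r" "r < 1" "\<And>z. z \<in> S \<Longrightarrow> cmod (1 + complex_of_real h * z) < r"
proof -
  (* h \<le> -Re z / |z|^2 gives |1 + h z|^2 = 1 + 2 h Re z + h^2 |z|^2 \<le> 1 + h Re z < 1 *)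
  define h where "h = Min (insert 1 ((\<lambda>z. - Re z / (cmod z)\<^sup>2) ` S))"
  have "- Re z / (cmod z)\<^sup>2 > 0" if "z \<in> S" for z
    using assms(2)[OF that] by (cases "z = 0") (auto intro!: divide_neg_pos)
  then have "h > 0"
    using assms(1) by (simp add: h_def)
  have "cmod (1 + complex_of_real h * z) < 1" if "z \<in> S" for z
  proof -
    have "Re z < 0" "z \<noteq> 0"
      using assms(2)[OF that] by auto
    have "h \<le> - Re z / (cmod z)\<^sup>2"
      using assms(1) that by (auto simp: h_def)
    then have "h * (cmod z)\<^sup>2 \<le> - Re z"
      using \<open>z \<noteq> 0\<close> by (simp add: field_simps)
    then have "h * (h * (cmod z)\<^sup>2) \<le> h * - Re z"
      using \<open>h > 0\<close> by (intro mult_left_mono) auto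
    then have "(cmod (1 + complex_of_real h * z))\<^sup>2 \<le> 1 + h * Re z"
      unfolding cmod_power2 by (simp add: power2_eq_square algebra_simps)
    also have "\<dots> < 1"
      using \<open>h > 0\<close> \<open>Re z < 0\<close> by (simp add: mult_pos_neg)
    finally show ?thesis
      by (simp add: power_less_one_iff)
  qed
  moreover define m where "m = Max (insert 0 ((\<lambda>z. cmod (1 + complex_of_real h * z)) ` S))"
  ultimately have "0 \<le> m" "m < 1" "\<And>z. z \<in> S \<Longrightarrow> cmod (1 + complex_of_real h * z) \<le> m"
    using assms(1) by (auto simp: m_def)
  then have "0 < (1 + m) / 2" "(1 + m) / 2 < 1"
    "\<And>z. z \<in> S \<Longrightarrow> cmod (1 + complex_of_real h * z) < (1 + m) / 2"
    by force+
  with \<open>h > 0\<close> show ?thesis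
    using that by blast
qed

lemma hurwitz_euler_matpow_decay:
  fixes \<Phi> :: "real^'n^'n"
  assumes "hurwitz \<Phi>"
  obtains h r c where "h > 0" "0 < r" "r < 1"
    "\<And>k a b. \<bar>matpow (mat 1 + h *\<^sub>R \<Phi>) k $ a $ b\<bar> \<le> c * r ^ k"
proof -
  obtain h r where "h > 0" "0 < r" "r < 1"
    and contraction: "\<And>z. eigenvalue \<Phi> z \<Longrightarrow> cmod (1 + complex_of_real h * z) < r"
    using euler_step_contraction[OF finite_eigenvalues[of \<Phi>]] assms
    by (auto simp: hurwitz_def)
  let ?B = "mat 1 + h *\<^sub>R \<Phi>"
  have "cmod \<mu> < 1" if "eigenvalue ((1 / r) *\<^sub>R ?B) \<mu>" for \<mu>
  proof -
    have "eigenvalue \<Phi> ((\<mu> * r - 1) / h)"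
      using that eigenvalue_affine_iff[of "1 / r" h \<Phi> \<mu>] \<open>h > 0\<close> \<open>r > 0\<close> by simp
    from contraction[OF this] have "cmod (\<mu> * r) < r"
      using \<open>h > 0\<close> by simp
    with \<open>r > 0\<close> show ?thesis
      by (simp add: norm_mult)
  qed
  then obtain c where c: "\<And>k a b. \<bar>matpow ((1 / r) *\<^sub>R ?B) k $ a $ b\<bar> \<le> c"
    using matpow_entries_bounded by blast
  have "\<bar>matpow ?B k $ a $ b\<bar> \<le> c * r ^ k" for k a b
    using c[of k a b, unfolded matpow_scaleR] \<open>r > 0\<close>
    by (simp add: abs_mult power_one_over field_simps)
  with \<open>h > 0\<close> \<open>r > 0\<close> \<open>r < 1\<close> show ?thesis
    using that by blast
qed

lemma hurwitz_euler_contraction: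
  fixes \<Phi> :: "real^'n^'n"
  assumes "hurwitz \<Phi>"
  obtains h N where "h > 0" "N > 0"
    "\<And>y. norm (matpow (mat 1 + h *\<^sub>R \<Phi>) N *v y) \<le> 1/2 * norm y"
proof -
  obtain h r c where "h > 0" "0 < r" "r < 1"
    and decay: "\<And>k a b. \<bar>matpow (mat 1 + h *\<^sub>R \<Phi>) k $ a $ b\<bar> \<le> c * r ^ k"
    using hurwitz_euler_matpow_decay[OF assms] by blast
  let ?bound = "\<lambda>k. real CARD('n) * real CARD('n) * (c * r ^ k)"
  have "?bound \<longlonglongrightarrow> 0"
    using \<open>0 < r\<close> \<open>r < 1\<close> by (intro tendsto_mult_right_zero LIMSEQ_realpow_zero) auto
  then obtain N0 where N0: "\<And>k. k \<ge> N0 \<Longrightarrow> ?bound k < 1/2"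
    using order_tendstoD(2)[of ?bound 0 sequentially "1/2"] by (auto simp: eventually_sequentially)
  have "norm (matpow (mat 1 + h *\<^sub>R \<Phi>) (Suc N0) *v y) \<le> 1/2 * norm y" for y
  proof -
    have "spectral_norm (matpow (mat 1 + h *\<^sub>R \<Phi>) (Suc N0)) \<le> ?bound (Suc N0)"
      unfolding spectral_norm_def by (rule onorm_le_matrix_component) (rule decay)
    with N0[of "Suc N0"] have "spectral_norm (matpow (mat 1 + h *\<^sub>R \<Phi>) (Suc N0)) \<le> 1/2"
      by simp
    then show ?thesis
      by (meson norm_ge_zero norm_matrix_vector_le mult_right_mono order_trans)
  qed
  with \<open>h > 0\<close> show ?thesis
    using that[of h "Suc N0"] by blast
qed

lemma has_real_derivative_power2_norm:
  assumes "(f has_vector_derivative f') (at t)"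
  shows "((\<lambda>t. (norm (f t))\<^sup>2) has_real_derivative 2 * (f t \<bullet> f')) (at t)"
proof -
  have "((\<lambda>t. f t \<bullet> f t) has_derivative (\<lambda>s. f t \<bullet> (s *\<^sub>R f') + (s *\<^sub>R f') \<bullet> f t)) (at t)"
    using assms unfolding has_vector_derivative_def by (intro has_derivative_inner)
  moreover have "(\<lambda>s. f t \<bullet> (s *\<^sub>R f') + (s *\<^sub>R f') \<bullet> f t) = (*) (2 * (f t \<bullet> f'))"
    by (rule ext) (simp add: inner_commute algebra_simps)
  ultimately show ?thesis
    unfolding has_field_derivative_def power2_norm_eq_inner by simp
qed

lemma exp_decay_of_derivative_le:
  fixes V V' :: "real \<Rightarrow> real"
  assumes "\<And>s. (V has_real_derivative V' s) (at s)"
    and "\<And>s. V' s \<le> - \<beta> * V s"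
    and "0 \<le> t"
  shows "V t \<le> exp (- \<beta> * t) * V 0"
proof -
  define W where "W s = exp (\<beta> * s) * V s" for s
  have "W t \<le> W 0"
  proof (rule DERIV_nonpos_imp_nonincreasing[OF \<open>0 \<le> t\<close>])
    fix s
    have "(W has_real_derivative exp (\<beta> * s) * (\<beta> * V s + V' s)) (at s)"
      unfolding W_def by (auto intro!: derivative_eq_intros assms(1) simp: algebra_simps)
    moreover have "exp (\<beta> * s) * (\<beta> * V s + V' s) \<le> 0"
      using assms(2)[of s] by (simp add: mult_nonneg_nonpos)
    ultimately show "\<exists>y. (W has_real_derivative y) (at s) \<and> y \<le> 0"
      by blast
  qed
  then show ?thesis
    by (simp add: W_def exp_minus field_simps)
qed

definition euler_lyapunov :: "real^'n^'n \<Rightarrow> nat \<Rightarrow> real^'n \<Rightarrow> real" where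
  "euler_lyapunov B N y = (\<Sum>k<N. (norm (matpow B k *v y))\<^sup>2)"

lemma euler_lyapunov_ge: "N > 0 \<Longrightarrow> (norm y)\<^sup>2 \<le> euler_lyapunov B N y"
  unfolding euler_lyapunov_def
  using member_le_sum[of 0 "{..<N}" "\<lambda>k. (norm (matpow B k *v y))\<^sup>2"] by simp

lemma euler_lyapunov_le:
  "euler_lyapunov B N y \<le> (\<Sum>k<N. (spectral_norm (matpow B k))\<^sup>2) * (norm y)\<^sup>2"
  unfolding euler_lyapunov_def sum_distrib_right power_mult_distrib[symmetric]
  by (intro sum_mono power_mono norm_matrix_vector_le) simp

lemma euler_lyapunov_has_derivative:
  assumes "(x has_vector_derivative \<Phi> *v x t) (at t)"
  shows "((\<lambda>t. euler_lyapunov B N (x t)) has_real_derivative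
           (\<Sum>k<N. 2 * ((matpow B k *v x t) \<bullet> (matpow B k *v (\<Phi> *v x t))))) (at t)"
  unfolding euler_lyapunov_def
  by (intro DERIV_sum has_real_derivative_power2_norm
      bounded_linear.has_vector_derivative[OF matrix_vector_mul_bounded_linear assms])

lemma euler_lyapunov_derivative_le:
  fixes \<Phi> :: "real^'n^'n" and h :: real
  defines "B \<equiv> mat 1 + h *\<^sub>R \<Phi>"
  assumes "h > 0" and contraction: "\<And>y. norm (matpow B N *v y) \<le> 1/2 * norm y"
  shows "(\<Sum>k<N. 2 * ((matpow B k *v y) \<bullet> (matpow B k *v (\<Phi> *v y)))) \<le> - 3 / (4 * h) * (norm y)\<^sup>2"
proof -
  let ?x = "\<lambda>k. matpow B k *v y"
  have "?x (Suc k) = matpow B k *v (y + h *\<^sub>R (\<Phi> *v y))" for k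
    unfolding matpow_Suc_right matrix_vector_mul_assoc[symmetric]
    by (simp add: B_def algebra_simps scaleR_matrix_vector_assoc[symmetric])
  then have step: "matpow B k *v (\<Phi> *v y) = (1 / h) *\<^sub>R (?x (Suc k) - ?x k)" for k
    using \<open>h > 0\<close> by (simp add: matrix_vector_right_distrib matrix_vector_mult_scaleR)
  have two_inner_le: "2 * (a \<bullet> (b - a)) \<le> (norm b)\<^sup>2 - (norm a)\<^sup>2" for a b :: "real^'n"
    using power2_norm_eq_inner[of "b - a"] zero_le_power2[of "norm (b - a)"]
    by (simp add: power2_norm_eq_inner inner_diff_left inner_diff_right inner_commute)
  have "2 * (?x k \<bullet> (matpow B k *v (\<Phi> *v y)))
      \<le> (1 / h) * ((norm (?x (Suc k)))\<^sup>2 - (norm (?x k))\<^sup>2)" for k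
  proof -
    have "2 * (?x k \<bullet> (matpow B k *v (\<Phi> *v y))) = (1 / h) * (2 * (?x k \<bullet> (?x (Suc k) - ?x k)))"
      unfolding step by simp
    also have "\<dots> \<le> (1 / h) * ((norm (?x (Suc k)))\<^sup>2 - (norm (?x k))\<^sup>2)"
      using \<open>h > 0\<close> by (intro mult_left_mono two_inner_le) simp
    finally show ?thesis .
  qed
  then have "(\<Sum>k<N. 2 * (?x k \<bullet> (matpow B k *v (\<Phi> *v y))))
      \<le> (\<Sum>k<N. (1 / h) * ((norm (?x (Suc k)))\<^sup>2 - (norm (?x k))\<^sup>2))"
    by (rule sum_mono)
  also have "\<dots> = (1 / h) * ((norm (?x N))\<^sup>2 - (norm y)\<^sup>2)"
    unfolding sum_distrib_left[symmetric] sum_lessThan_telescope[of "\<lambda>k. (norm (?x k))\<^sup>2"]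
    by simp
  also have "\<dots> \<le> (1 / h) * ((1/2 * norm y)\<^sup>2 - (norm y)\<^sup>2)"
    using \<open>h > 0\<close> contraction[of y] by (intro mult_left_mono diff_right_mono power_mono) auto
  also have "\<dots> = - 3 / (4 * h) * (norm y)\<^sup>2"
    by (simp add: field_simps power2_eq_square)
  finally show ?thesis .
qed

lemma hurwitz_mat_exp_decay_power2:
  fixes \<Phi> :: "real^'n^'n"
  assumes "hurwitz \<Phi>"
  obtains K \<beta> where "K > 0" "\<beta> > 0"
    "\<And>t v. 0 \<le> t \<Longrightarrow> (norm (mat_exp (t *\<^sub>R \<Phi>) *v v))\<^sup>2 \<le> K * exp (- \<beta> * t) * (norm v)\<^sup>2"
proof -
  obtain h N where "h > 0" "N > 0"
    and contraction: "\<And>y. norm (matpow (mat 1 + h *\<^sub>R \<Phi>) N *v y) \<le> 1/2 * norm y"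
    using hurwitz_euler_contraction[OF assms] by blast
  define V where "V = euler_lyapunov (mat 1 + h *\<^sub>R \<Phi>) N"
  define K where "K = 1 + (\<Sum>k<N. (spectral_norm (matpow (mat 1 + h *\<^sub>R \<Phi>) k))\<^sup>2)"
  define \<beta> where "\<beta> = 3 / (4 * h * K)"
  have "K > 0"
    unfolding K_def by (simp add: add_pos_nonneg sum_nonneg)
  have V_le: "V y \<le> K * (norm y)\<^sup>2" for y
    using euler_lyapunov_le[of "mat 1 + h *\<^sub>R \<Phi>" N y]
    unfolding V_def K_def by (simp add: distrib_right add_increasing)
  have "(norm (mat_exp (t *\<^sub>R \<Phi>) *v v))\<^sup>2 \<le> K * exp (- \<beta> * t) * (norm v)\<^sup>2"
    if "0 \<le> t" for t v
  proof -
    let ?x = "\<lambda>t. mat_exp (t *\<^sub>R \<Phi>) *v v"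
    let ?D = "\<lambda>t. \<Sum>k<N. 2 * ((matpow (mat 1 + h *\<^sub>R \<Phi>) k *v ?x t)
                               \<bullet> (matpow (mat 1 + h *\<^sub>R \<Phi>) k *v (\<Phi> *v ?x t)))"
    have derivative: "((\<lambda>s. V (?x s)) has_real_derivative ?D s) (at s)" for s
      unfolding V_def by (intro euler_lyapunov_has_derivative mat_exp_has_vector_derivative)
    have "?D s \<le> - \<beta> * V (?x s)" for s
    proof -
      have "\<beta> * V (?x s) \<le> \<beta> * (K * (norm (?x s))\<^sup>2)"
        using V_le \<open>h > 0\<close> \<open>K > 0\<close> by (intro mult_left_mono) (auto simp: \<beta>_def)
      also have "\<dots> = 3 / (4 * h) * (norm (?x s))\<^sup>2"
        using \<open>K > 0\<close> by (simp add: \<beta>_def)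
      finally show ?thesis
        using euler_lyapunov_derivative_le[OF \<open>h > 0\<close> contraction, of "?x s"] by simp
    qed
    then have "V (?x t) \<le> exp (- \<beta> * t) * V (?x 0)"
      by (intro exp_decay_of_derivative_le[OF derivative _ \<open>0 \<le> t\<close>])
    also have "\<dots> \<le> exp (- \<beta> * t) * (K * (norm v)\<^sup>2)"
      using V_le[of v] by simp
    finally show ?thesis
      using euler_lyapunov_ge[OF \<open>N > 0\<close>, of "?x t" "mat 1 + h *\<^sub>R \<Phi>"]
      by (simp add: V_def mult_ac)
  qed
  moreover have "\<beta> > 0"
    using \<open>h > 0\<close> \<open>K > 0\<close> by (simp add: \<beta>_def)
  ultimately show ?thesis
    using that \<open>K > 0\<close> by blast
qed

lemma hurwitz_mat_exp_decay:
  fixes \<Phi> :: "real^'n^'n"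
  assumes "hurwitz \<Phi>"
  obtains \<alpha> C where "\<alpha> > 0"
    "\<And>t v. 0 \<le> t \<Longrightarrow> norm (mat_exp (t *\<^sub>R \<Phi>) *v v) \<le> C * exp (- \<alpha> * t) * norm v"
proof -
  obtain K \<beta> where "K > 0" "\<beta> > 0" and decay:
    "\<And>t v. 0 \<le> t \<Longrightarrow> (norm (mat_exp (t *\<^sub>R \<Phi>) *v v))\<^sup>2 \<le> K * exp (- \<beta> * t) * (norm v)\<^sup>2"
    using hurwitz_mat_exp_decay_power2[OF assms] by metis
  have "norm (mat_exp (t *\<^sub>R \<Phi>) *v v) \<le> sqrt K * exp (- (\<beta> / 2) * t) * norm v"
    if "0 \<le> t" for t v
  proof (rule power2_le_imp_le)
    have "exp (- \<beta> * t) = (exp (- (\<beta> / 2) * t))\<^sup>2"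
      by (subst exp_of_nat_mult[of 2, symmetric]) simp
    then show "(norm (mat_exp (t *\<^sub>R \<Phi>) *v v))\<^sup>2 \<le> (sqrt K * exp (- (\<beta> / 2) * t) * norm v)\<^sup>2"
      using decay[OF that, of v] \<open>K > 0\<close> by (simp add: power_mult_distrib)
  qed (use \<open>K > 0\<close> in simp)
  moreover have "\<beta> / 2 > 0"
    using \<open>\<beta> > 0\<close> by simp
  ultimately show ?thesis
    using that by blast
qed

section \<open>Positive semidefinite matrices\<close>

lemma inner_matrix_vector_symmetric:
  fixes \<Psi> :: "real^'n^'n"
  assumes "transpose \<Psi> = \<Psi>"
  shows "x \<bullet> (\<Psi> *v y) = (\<Psi> *v x) \<bullet> y"
  using dot_lmul_matrix[of x \<Psi> y] vector_transpose_matrix[of x \<Psi>] assms by simp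

lemma psd_cauchy_schwarz:
  fixes \<Psi> :: "real^'n^'n"
  assumes "transpose \<Psi> = \<Psi>" and psd: "\<forall>x. 0 \<le> x \<bullet> (\<Psi> *v x)"
  shows "(y \<bullet> (\<Psi> *v z))\<^sup>2 \<le> (y \<bullet> (\<Psi> *v y)) * (z \<bullet> (\<Psi> *v z))"
proof -
  define a b c where "a = y \<bullet> (\<Psi> *v y)" and "b = y \<bullet> (\<Psi> *v z)" and "c = z \<bullet> (\<Psi> *v z)"
  have quadratic: "0 \<le> a + 2 * s * b + s\<^sup>2 * c" for s
  proof -
    have "z \<bullet> (\<Psi> *v y) = b"
      unfolding b_def inner_matrix_vector_symmetric[OF assms(1), of z] by (rule inner_commute)
    then have "(y + s *\<^sub>R z) \<bullet> (\<Psi> *v (y + s *\<^sub>R z)) = a + 2 * s * b + s\<^sup>2 * c"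
      by (simp add: a_def b_def c_def matrix_vector_right_distrib matrix_vector_mult_scaleR
          inner_add_left inner_add_right power2_eq_square algebra_simps)
    with psd show ?thesis
      by metis
  qed
  have "c \<ge> 0"
    using psd by (simp add: c_def)
  show ?thesis
  proof (cases "c = 0")
    case True
    have "b = 0"
    proof (rule ccontr)
      assume "b \<noteq> 0"
      with True quadratic[of "- (a + 1) / (2 * b)"] show False
        by (simp add: field_simps)
    qed
    with True show ?thesis
      by (simp add: b_def c_def)
  next
    case False
    with \<open>c \<ge> 0\<close> quadratic[of "- b / c"] have "b\<^sup>2 / c \<le> a"
      by (simp add: field_simps power2_eq_square)
    with False \<open>c \<ge> 0\<close> show ?thesis
      by (simp add: a_def b_def c_def pos_divide_le_eq)
  qed
qed

lemma psd_spectral_norm_attained: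
  fixes \<Psi> :: "real^'n^'n"
  assumes sym: "transpose \<Psi> = \<Psi>" and psd: "\<forall>x. 0 \<le> x \<bullet> (\<Psi> *v x)"
  obtains v where "norm v = 1" "v \<bullet> (\<Psi> *v v) = spectral_norm \<Psi>"
proof -
  let ?q = "\<lambda>x. x \<bullet> (\<Psi> *v x)"
  have "sphere 0 1 \<noteq> ({} :: (real^'n) set)"
    using norm_axis_1[of "undefined :: 'n"] by (metis mem_sphere_0 empty_iff)
  moreover have "continuous_on (sphere 0 1) ?q"
    by (intro continuous_intros linear_continuous_on) simp
  ultimately obtain v where "v \<in> sphere 0 1" and v_max: "\<And>y. y \<in> sphere 0 1 \<Longrightarrow> ?q y \<le> ?q v"
    using continuous_attains_sup[of "sphere 0 1" ?q] by auto
  then have "norm v = 1"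
    by simp
  define m where "m = ?q v"
  have "0 \<le> m"
    using psd by (simp add: m_def)
  have q_le: "?q y \<le> m * (norm y)\<^sup>2" for y
  proof (cases "y = 0")
    case False
    then have "?q ((1 / norm y) *\<^sub>R y) \<le> m"
      unfolding m_def by (intro v_max) simp
    moreover have "?q ((1 / norm y) *\<^sub>R y) = ?q y / (norm y)\<^sup>2"
      unfolding matrix_vector_mult_scaleR by (simp add: power2_eq_square)
    ultimately have "?q y / (norm y)\<^sup>2 \<le> m"
      by linarith
    with False show ?thesis
      using pos_divide_le_eq[of "(norm y)\<^sup>2" "?q y" m] by simp
  qed simp
  have "norm (\<Psi> *v y) \<le> m * norm y" for y
  proof -
    let ?z = "\<Psi> *v y"
    have "(norm ?z)\<^sup>2 = y \<bullet> (\<Psi> *v ?z)"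
      using inner_matrix_vector_symmetric[OF sym, of y ?z] by (simp add: power2_norm_eq_inner)
    then have "((norm ?z)\<^sup>2)\<^sup>2 \<le> ?q y * ?q ?z"
      by (simp only: psd_cauchy_schwarz[OF sym psd])
    also have "\<dots> \<le> (m * (norm y)\<^sup>2) * (m * (norm ?z)\<^sup>2)"
      by (rule mult_mono[OF q_le q_le]) (use psd \<open>0 \<le> m\<close> in auto)
    also have "\<dots> = (m * norm y * norm ?z)\<^sup>2"
      by (simp add: power2_eq_square mult_ac)
    finally have "norm ?z * norm ?z \<le> (m * norm y) * norm ?z"
      unfolding power2_eq_square[of "norm ?z", symmetric]
      by (rule power2_le_imp_le) (use \<open>0 \<le> m\<close> in simp)
    then show ?thesis
      using \<open>0 \<le> m\<close> by (cases "?z = 0") (auto dest: mult_right_le_imp_le)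
  qed
  then have "spectral_norm \<Psi> \<le> m"
    unfolding spectral_norm_def using \<open>0 \<le> m\<close> by (intro onorm_bound) auto
  moreover have "m \<le> spectral_norm \<Psi>"
    using norm_cauchy_schwarz[of v "\<Psi> *v v"] norm_matrix_vector_le[of \<Psi> v] \<open>norm v = 1\<close>
    by (simp add: m_def)
  ultimately show ?thesis
    using that \<open>norm v = 1\<close> m_def by force
qed

lemma psd_quadratic_form_near_maximiser:
  fixes \<Psi> :: "real^'n^'n"
  assumes sym: "transpose \<Psi> = \<Psi>" and psd: "\<forall>x. 0 \<le> x \<bullet> (\<Psi> *v x)"
    and "norm v = 1" "v \<bullet> (\<Psi> *v v) = spectral_norm \<Psi>" "norm (x - v) \<le> 1/4"
  shows "spectral_norm \<Psi> / 2 \<le> x \<bullet> (\<Psi> *v x)"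
proof -
  define w where "w = x - v"
  have "x = v + w"
    by (simp add: w_def)
  moreover have "v \<bullet> (\<Psi> *v w) = w \<bullet> (\<Psi> *v v)"
    using inner_matrix_vector_symmetric[OF sym, of v w] by (simp add: inner_commute)
  ultimately have "x \<bullet> (\<Psi> *v x) = spectral_norm \<Psi> + 2 * (w \<bullet> (\<Psi> *v v)) + w \<bullet> (\<Psi> *v w)"
    using assms(4) by (simp add: matrix_vector_right_distrib inner_add_left inner_add_right)
  moreover have "\<bar>w \<bullet> (\<Psi> *v v)\<bar> \<le> 1/4 * spectral_norm \<Psi>"
  proof -
    have "\<bar>w \<bullet> (\<Psi> *v v)\<bar> \<le> norm w * norm (\<Psi> *v v)"
      by (rule Cauchy_Schwarz_ineq2)
    also have "\<dots> \<le> 1/4 * spectral_norm \<Psi>"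
      using norm_matrix_vector_le[of \<Psi> v] \<open>norm v = 1\<close> assms(5)
      by (intro mult_mono) (auto simp: w_def)
    finally show ?thesis .
  qed
  moreover have "0 \<le> w \<bullet> (\<Psi> *v w)"
    using psd by simp
  ultimately show ?thesis
    by linarith
qed

section \<open>The Lyapunov integral\<close>

lemma inner_transpose_mult_mult:
  fixes E \<Psi> :: "real^'n^'n"
  shows "a \<bullet> ((transpose E ** \<Psi> ** E) *v b) = (E *v a) \<bullet> (\<Psi> *v (E *v b))"
proof -
  have "a \<bullet> ((transpose E ** \<Psi> ** E) *v b) = a \<bullet> (transpose E *v (\<Psi> *v (E *v b)))"
    by (simp add: matrix_vector_mul_assoc matrix_mul_assoc)
  also have "\<dots> = (a v* transpose E) \<bullet> (\<Psi> *v (E *v b))"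
    by (rule dot_lmul_matrix[symmetric])
  finally show ?thesis
    by (simp add: vector_transpose_matrix)
qed

lemma entry_eq_inner_axis: "A $ i $ j = axis i 1 \<bullet> (A *v axis j (1::real))"
  using cart_eq_inner_axis[of "A *v axis j 1" i]
  by (simp add: inner_commute matrix_vector_mult_basis column_def)

lemma integrable_lyapunov_integrand:
  fixes \<Phi> \<Psi> :: "real^'n^'n"
  assumes "hurwitz \<Phi>"
  shows "(\<lambda>t. transpose (mat_exp (t *\<^sub>R \<Phi>)) ** \<Psi> ** mat_exp (t *\<^sub>R \<Phi>)) integrable_on {0..}"
proof -
  obtain \<alpha> C where "\<alpha> > 0"
    and decay: "\<And>t v. 0 \<le> t \<Longrightarrow> norm (mat_exp (t *\<^sub>R \<Phi>) *v v) \<le> C * exp (- \<alpha> * t) * norm v"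
    using hurwitz_mat_exp_decay[OF assms] by metis
  let ?x = "\<lambda>t i. mat_exp (t *\<^sub>R \<Phi>) *v axis i 1"
  let ?M = "\<lambda>t. transpose (mat_exp (t *\<^sub>R \<Phi>)) ** \<Psi> ** mat_exp (t *\<^sub>R \<Phi>)"
  have entries: "?M t = (\<chi> i j. ?x t i \<bullet> (\<Psi> *v ?x t j))" for t
    unfolding Finite_Cartesian_Product.vec_eq_iff entry_eq_inner_axis[of "?M t"]
      inner_transpose_mult_mult by simp
  let ?K = "real CARD('n) * real CARD('n) * (spectral_norm \<Psi> * C\<^sup>2)"
  have bound: "norm (?M t) \<le> ?K * exp (- (2 * \<alpha>) * t)" if "t \<in> {0..}" for t
  proof -
    have "\<bar>?x t i \<bullet> (\<Psi> *v ?x t j)\<bar> \<le> spectral_norm \<Psi> * C\<^sup>2 * exp (- (2 * \<alpha>) * t)" for i j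
    proof -
      have "\<bar>?x t i \<bullet> (\<Psi> *v ?x t j)\<bar> \<le> norm (?x t i) * norm (\<Psi> *v ?x t j)"
        by (rule Cauchy_Schwarz_ineq2)
      also have "\<dots> \<le> norm (?x t i) * (spectral_norm \<Psi> * norm (?x t j))"
        by (intro mult_left_mono norm_matrix_vector_le) simp
      also have "\<dots> \<le> (C * exp (- \<alpha> * t)) * (spectral_norm \<Psi> * (C * exp (- \<alpha> * t)))"
        using decay[of t "axis _ 1"] that spectral_norm_nonneg[of \<Psi>]
        by (intro mult_mono mult_left_mono)
          (auto simp: norm_axis_1 intro: order_trans[OF norm_ge_zero])
      also have "\<dots> = spectral_norm \<Psi> * C\<^sup>2 * exp (- (2 * \<alpha>) * t)"
        by (simp add: power2_eq_square algebra_simps flip: exp_add)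
      finally show ?thesis .
    qed
    then show ?thesis
      unfolding entries using norm_matrix_le_entries[of "\<chi> i j. ?x t i \<bullet> (\<Psi> *v ?x t j)"]
      by (simp add: mult.assoc)
  qed
  have "continuous_on {0..} ?M"
    unfolding entries
    by (intro continuous_on_vec_lambda continuous_on_inner continuous_on_mat_exp_apply
        linear_continuous_on_compose[OF continuous_on_mat_exp_apply] matrix_vector_mul_linear)
  then have "?M \<in> borel_measurable (lebesgue_on {0..})"
    by (rule continuous_imp_measurable_on_sets_lebesgue) simp
  moreover have "(\<lambda>t. ?K * exp (- (2 * \<alpha>) * t)) integrable_on {0..}"
    using \<open>\<alpha> > 0\<close> by (intro integrable_on_mult_right integrable_on_exp_minus_to_infinity) simp
  ultimately show ?thesis
    using bound by (rule measurable_bounded_by_integrable_imp_integrable) auto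
qed

lemma has_integral_inner_lyapunov_integrand:
  fixes \<Phi> \<Psi> :: "real^'n^'n"
  assumes "hurwitz \<Phi>"
  shows "((\<lambda>t. (mat_exp (t *\<^sub>R \<Phi>) *v v) \<bullet> (\<Psi> *v (mat_exp (t *\<^sub>R \<Phi>) *v v))) has_integral
           v \<bullet> (integral {0..} (\<lambda>t. transpose (mat_exp (t *\<^sub>R \<Phi>)) ** \<Psi> ** mat_exp (t *\<^sub>R \<Phi>)) *v v))
         {0..}"
proof -
  have "bounded_linear (\<lambda>X :: real^'n^'n. v \<bullet> (X *v v))"
    by (intro bounded_linear_compose[OF bounded_linear_inner_right]
        bounded_linear_matrix_vector_mul_left)
  from has_integral_linear[OF integrable_integral[OF integrable_lyapunov_integrand[OF assms]] this]
  show ?thesis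
    by (simp add: o_def inner_transpose_mult_mult)
qed

lemma integral_ge_initial_segment:
  fixes f :: "real \<Rightarrow> real"
  assumes "(f has_integral I) {0..}" "\<And>t. 0 \<le> t \<Longrightarrow> 0 \<le> f t"
    and "0 \<le> c" "\<And>t. 0 \<le> t \<Longrightarrow> t \<le> c \<Longrightarrow> b \<le> f t"
  shows "c * b \<le> I"
proof -
  have "f integrable_on {0..c}"
    using assms(1) by (rule integrable_on_subinterval[OF has_integral_integrable]) auto
  have "c * b = integral {0..c} (\<lambda>_. b)"
    using \<open>0 \<le> c\<close> by simp
  also have "\<dots> \<le> integral {0..c} f"
    using assms(4) by (intro integral_le[OF integrable_const_ivl \<open>f integrable_on {0..c}\<close>]) auto
  also have "\<dots> \<le> integral {0..} f"
    using assms(1,2) by (intro integral_subset_le \<open>f integrable_on {0..c}\<close>) auto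
  finally show ?thesis
    using assms(1) by (simp add: integral_unique)
qed

theorem lemma3:
  fixes \<Psi> \<Phi> :: "real^'n^'n"
  assumes "transpose \<Psi> = \<Psi>"
    and "\<forall>x. 0 \<le> x \<bullet> (\<Psi> *v x)"
    and "hurwitz \<Phi>"
  shows "spectral_norm
           (integral {0..} (\<lambda>t::real. transpose (mat_exp (t *\<^sub>R \<Phi>)) ** \<Psi> ** mat_exp (t *\<^sub>R \<Phi>)))
         \<ge> 1/2 * (ln (5/4) / spectral_norm \<Phi>) * spectral_norm \<Psi>"
proof -
  let ?\<Theta> = "integral {0..} (\<lambda>t::real. transpose (mat_exp (t *\<^sub>R \<Phi>)) ** \<Psi> ** mat_exp (t *\<^sub>R \<Phi>))"
  let ?c = "ln (5/4) / spectral_norm \<Phi>"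
  obtain v where v: "norm v = 1" "v \<bullet> (\<Psi> *v v) = spectral_norm \<Psi>"
    using psd_spectral_norm_attained[OF assms(1,2)] by blast
  have "spectral_norm \<Psi> / 2 \<le> (mat_exp (t *\<^sub>R \<Phi>) *v v) \<bullet> (\<Psi> *v (mat_exp (t *\<^sub>R \<Phi>) *v v))"
    if "0 \<le> t" "t \<le> ?c" for t
  proof (rule psd_quadratic_form_near_maximiser[OF assms(1,2) v])
    (* if \<parallel>\<Phi>\<parallel> = 0 then ?c = 0, as division by zero yields zero *)
    have "t * spectral_norm \<Phi> \<le> ln (5/4)"
      using that spectral_norm_nonneg[of \<Phi>]
      by (cases "spectral_norm \<Phi> = 0") (auto simp: pos_le_divide_eq)
    then show "norm (mat_exp (t *\<^sub>R \<Phi>) *v v - v) \<le> 1/4"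
      using norm_mat_exp_apply_diff_le_quarter[OF \<open>0 \<le> t\<close>, of \<Phi> v] v(1) by simp
  qed
  then have "?c * (spectral_norm \<Psi> / 2) \<le> v \<bullet> (?\<Theta> *v v)"
    using assms(2) spectral_norm_nonneg[of \<Phi>]
    by (intro integral_ge_initial_segment[OF has_integral_inner_lyapunov_integrand[OF assms(3)]])
      auto
  also have "\<dots> \<le> spectral_norm ?\<Theta>"
    using norm_cauchy_schwarz[of v "?\<Theta> *v v"] norm_matrix_vector_le[of ?\<Theta> v] v(1) by simp
  finally show ?thesis
    by simp
qed

end
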